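(* Let $\nu>0$. There is no efficient statistical-query algorithm with non-trivial performance on the family of distributions on $\{\pm 1\}^n\times\{\pm 1\}$ that are $2^{-\log^{1-\nu}(n)}$-almost-realizable-with-margin.
   Context: A statistical-query (SQ) algorithm interacts with the unknown distribution $\mathcal D$ on $\{\pm1\}^n\times\{\pm1\}$ only through queries: it specifies a function $Q:\{\pm1\}^n\times\{\pm1\}\to\{\pm1\}$ and a tolerance $\lambda>0$ and receives some number $e$ with $|\mathbb{E}_{(x,y)\sim\mathcal D}[Q(x,y)]-e|\le\lambda$. It is efficient if it makes polynomially many queries, each with $1/\lambda\le\mathrm{poly}(n)$, and runs in polynomial time; it outputs a hypothesis $h:\{\pm1\}^n\to\{\pm1\}$. $\mathrm{Err}_{\mathcal D}(h)=\Pr_{(x,y)\sim\mathcal D}(h(x)\ne y)$. Non-trivial performance on a family: for some constant $c>0$ the output satisfies $\mathrm{Err}_{\mathcal D}(h)\le\frac12-\frac1{n^c}$ whenever $\mathcal D$ is in the family. $\mathcal D$ is $\eta$-almost-realizable-with-margin if there is $w\in\mathbb{R}^n$ with $\sum_i|w_i|\le\mathrm{poly}(n)$ such that $\Pr_{(x,y)\sim\mathcal D}(y\langle w,x\rangle\le1)\le\eta$. *)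

theory Defs
  imports "HOL-Probability.Probability" "HOL-Library.Landau_Symbols"
begin

definition poly_bounded :: "(nat \<Rightarrow> real) \<Rightarrow> bool" where
  "poly_bounded f \<longleftrightarrow> (\<exists>k::nat. f \<in> O(\<lambda>n. real n ^ k))"

subsection \<open>Distributions on labelled sign vectors\<close>

definition sign_vectors :: "nat \<Rightarrow> int list set" where
  "sign_vectors n = {x. length x = n \<and> set x \<subseteq> {-1, 1}}"

definition examples :: "nat \<Rightarrow> (int list \<times> int) set" where
  "examples n = sign_vectors n \<times> {-1, 1}"

definition distributions :: "nat \<Rightarrow> (int list \<times> int) pmf set" where
  "distributions n = {D. set_pmf D \<subseteq> examples n}"

definition Err :: "(int list \<times> int) pmf \<Rightarrow> (int list \<Rightarrow> int) \<Rightarrow> real" where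
  "Err D h = measure_pmf.prob D {(x, y). h x \<noteq> y}"

text \<open>Only the components \<open>w i\<close> with \<open>i < n\<close> matter, so \<open>w\<close> stands for a vector of
  dimension \<open>n\<close>. The bound \<open>b\<close> on its 1-norm is a parameter, to be instantiated with a
  polynomially bounded function of \<open>n\<close>.\<close>
definition almost_realizable_with_margin ::
    "nat \<Rightarrow> real \<Rightarrow> real \<Rightarrow> (int list \<times> int) pmf \<Rightarrow> bool" where
  "almost_realizable_with_margin n b \<eta> D \<longleftrightarrow>
     (\<exists>w::nat \<Rightarrow> real. (\<Sum>i<n. \<bar>w i\<bar>) \<le> b \<and>
        measure_pmf.prob D {(x, y). real_of_int y * (\<Sum>i<n. w i * real_of_int (x ! i)) \<le> 1} \<le> \<eta>)"

subsection \<open>Polynomial-time Turing machines\<close>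

text \<open>Deterministic machines with a single two-way infinite tape. States and tape symbols are
  numbers below the given bounds; symbol 0 is the blank, state 1 the initial state and state 0
  the halting state.\<close>

datatype head_move = Go_Left | Stay | Go_Right

record tm =
  num_states :: nat
  num_symbols :: nat
  trans :: "nat \<Rightarrow> nat \<Rightarrow> nat \<times> nat \<times> head_move"

text \<open>The bound 5 leaves room for the symbols 1, 2, 3, 4 used by the encodings below.\<close>
definition wf_tm :: "tm \<Rightarrow> bool" where
  "wf_tm M \<longleftrightarrow> num_states M \<ge> 2 \<and> num_symbols M \<ge> 5 \<and>
     (\<forall>q < num_states M. \<forall>s < num_symbols M.
        trans M q s \<in> {..<num_states M} \<times> {..<num_symbols M} \<times> UNIV)"

fun head_shift :: "head_move \<Rightarrow> int" where
  "head_shift Go_Left = -1"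
| "head_shift Stay = 0"
| "head_shift Go_Right = 1"

fun tm_step :: "tm \<Rightarrow> nat \<times> (int \<Rightarrow> nat) \<times> int \<Rightarrow> nat \<times> (int \<Rightarrow> nat) \<times> int" where
  "tm_step M (q, t, p) =
     (if q = 0 then (q, t, p)
      else case trans M q (t p) of (q', s, d) \<Rightarrow> (q', t(p := s), p + head_shift d))"

definition tm_init :: "nat list \<Rightarrow> nat \<times> (int \<Rightarrow> nat) \<times> int" where
  "tm_init u = (1, (\<lambda>i. if 0 \<le> i \<and> nat i < length u then u ! nat i else 0), 0)"

text \<open>The output is the word starting at cell 0 and ending before the next blank; output words
  are themselves free of blanks.\<close>
definition tm_outputs_within :: "tm \<Rightarrow> nat list \<Rightarrow> nat \<Rightarrow> nat list \<Rightarrow> bool" where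
  "tm_outputs_within M u T v \<longleftrightarrow>
     (\<exists>t p. (tm_step M ^^ T) (tm_init u) = (0, t, p) \<and>
        (\<forall>i < length v. t (int i) = v ! i) \<and> t (int (length v)) = 0)"

subsection \<open>Encodings\<close>

text \<open>Symbols: 1 and 2 are the binary digits zero and one, 3 is a separator, 4 the minus sign.\<close>

text \<open>Least significant digit first.\<close>
fun enc_nat :: "nat \<Rightarrow> nat list" where
  "enc_nat m = (if m = 0 then [] else (if odd m then 2 else 1) # enc_nat (m div 2))"

declare enc_nat.simps [simp del]

definition enc_int :: "int \<Rightarrow> nat list" where
  "enc_int z = (if z < 0 then [4] else []) @ enc_nat (nat \<bar>z\<bar>)"

definition enc_rat :: "rat \<Rightarrow> nat list" where
  "enc_rat r = (case quotient_of r of (a, b) \<Rightarrow> enc_int a @ [3] @ enc_int b)"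

definition enc_sign :: "int \<Rightarrow> nat" where
  "enc_sign s = (if s = 1 then 2 else 1)"

text \<open>The dimension is written in unary, so the length of the input is at least \<open>n\<close>.\<close>
definition enc_input :: "nat \<Rightarrow> rat list \<Rightarrow> int list \<times> int \<Rightarrow> nat list" where
  "enc_input n as z =
     replicate n 2 @ [3] @ map enc_sign (fst z) @ [enc_sign (snd z)] @
     concat (map (\<lambda>a. [3] @ enc_rat a) as)"

subsection \<open>Statistical-query algorithms\<close>

datatype sq_move =
  Query (query_fun: "int list \<times> int \<Rightarrow> int") (tolerance: rat)
| Output "int list \<Rightarrow> int"

text \<open>A deterministic interactive algorithm is given by its next-move function: from the
  dimension and the answers received so far it determines the next query or the final
  hypothesis. Tolerances and answers are exchanged with a Turing machine and hence rational.\<close>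
type_synonym sq_algorithm = "nat \<Rightarrow> rat list \<Rightarrow> sq_move"

text \<open>The answers \<open>as\<close> may be received, in this order, from the start of a run of \<open>A\<close> on \<open>D\<close>;
  the oracle is free to choose any answer within the tolerance.\<close>
definition sq_run :: "sq_algorithm \<Rightarrow> nat \<Rightarrow> (int list \<times> int) pmf \<Rightarrow> rat list \<Rightarrow> bool" where
  "sq_run A n D as \<longleftrightarrow>
     (\<forall>i < length as. \<exists>Q \<tau>. A n (take i as) = Query Q \<tau> \<and>
        \<bar>measure_pmf.expectation D (\<lambda>z. real_of_int (Q z)) - of_rat (as ! i)\<bar> \<le> of_rat \<tau>)"

fun legal_move :: "nat \<Rightarrow> sq_move \<Rightarrow> bool" where
  "legal_move n (Query Q \<tau>) \<longleftrightarrow> Q ` examples n \<subseteq> {-1, 1} \<and> \<tau> > 0"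
| "legal_move n (Output h) \<longleftrightarrow> h ` sign_vectors n \<subseteq> {-1, 1}"

definition legal_sq_algorithm :: "sq_algorithm \<Rightarrow> bool" where
  "legal_sq_algorithm A \<longleftrightarrow>
     (\<forall>n. \<forall>D \<in> distributions n. \<forall>as. sq_run A n D as \<longrightarrow> legal_move n (A n as))"

definition poly_many_queries :: "sq_algorithm \<Rightarrow> bool" where
  "poly_many_queries A \<longleftrightarrow>
     (\<exists>q. poly_bounded q \<and>
        (\<forall>n. \<forall>D \<in> distributions n. \<forall>as. sq_run A n D as \<longrightarrow> real (length as) \<le> q n))"

definition poly_tolerance :: "sq_algorithm \<Rightarrow> bool" where
  "poly_tolerance A \<longleftrightarrow>
     (\<exists>q. poly_bounded q \<and>
        (\<forall>n. \<forall>D \<in> distributions n. \<forall>as Q \<tau>.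
           sq_run A n D as \<and> A n as = Query Q \<tau> \<longrightarrow> 1 / of_rat \<tau> \<le> q n))"

text \<open>A query function or a hypothesis is specified by a program evaluating it: besides \<open>n\<close> and
  the answers so far, the machine receives a labelled example, and it announces the kind of the
  next move, the tolerance and the value of the query function (or hypothesis) on this example.\<close>
fun enc_move :: "sq_move \<Rightarrow> int list \<times> int \<Rightarrow> nat list" where
  "enc_move (Query Q \<tau>) z = [2, enc_sign (Q z)] @ enc_rat \<tau>"
| "enc_move (Output h) z = [1, enc_sign (h (fst z))]"

text \<open>The time is polynomial in the length of the input, to which both \<open>n\<close> (in unary) and the
  answers contribute, as the oracle may return rationals with long representations. As only
  polynomially many moves are made, this amounts to polynomial time for the whole interaction.\<close>
definition poly_time :: "sq_algorithm \<Rightarrow> bool" where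
  "poly_time A \<longleftrightarrow>
     (\<exists>M T. wf_tm M \<and> poly_bounded (\<lambda>l. real (T l)) \<and>
        (\<forall>n. \<forall>D \<in> distributions n. \<forall>as. sq_run A n D as \<longrightarrow>
           (\<forall>z \<in> examples n.
              tm_outputs_within M (enc_input n as z) (T (length (enc_input n as z)))
                (enc_move (A n as) z))))"

definition efficient_sq_algorithm :: "sq_algorithm \<Rightarrow> bool" where
  "efficient_sq_algorithm A \<longleftrightarrow>
     legal_sq_algorithm A \<and> poly_many_queries A \<and> poly_tolerance A \<and> poly_time A"

text \<open>The error bound is required for all large \<open>n\<close> only: for \<open>n = 1\<close> the number
  \<open>1/2 - 1/n^c\<close> is negative for every \<open>c\<close>.\<close>
definition nontrivial_performance ::
    "sq_algorithm \<Rightarrow> (nat \<Rightarrow> (int list \<times> int) pmf set) \<Rightarrow> bool" where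
  "nontrivial_performance A F \<longleftrightarrow>
     (\<exists>c>0. \<forall>\<^sub>F n in sequentially. \<forall>D \<in> F n. \<forall>as h.
        sq_run A n D as \<and> A n as = Output h \<longrightarrow> Err D h \<le> 1 / 2 - 1 / real n powr c)"

end

theory Submission
  imports Defs "HOL-Real_Asymp.Real_Asymp"
begin

text \<open>The hard distributions label a uniform \<open>x \<in> {\<plusminus>1}\<^sup>m\<close> by the parity of \<open>K\<close> of its
  bits and present it as the vector of all monomials of degree at most \<open>d\<close>, so that
  \<open>n = (m + 1)\<^sup>d\<close>. A univariate polynomial of degree \<open>d\<close> in the sum of the \<open>K\<close> relevant bits
  has the sign of the parity as long as this sum is at most \<open>d\<close> in absolute value, which by a
  Chernoff bound fails with probability at most \<open>2 exp (-d\<^sup>2 / 4K)\<close>; hence the distributions are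
  almost realizable. For the lower bound, all queries are answered as if the labels were
  independent uniform bits. The parities are orthogonal, so by Bessel's inequality every such answer is
  inadmissible for few parities only, and the final hypothesis correlates with few of
  them. Taking \<open>d = 2u\<^sup>a\<close>, \<open>K = 2u\<^sup>a\<^sup>+\<^sup>1\<close>, \<open>m = K\<^sup>2\<close> with \<open>a\<close> large in terms of
  \<open>1/\<nu>\<close>, there are at least \<open>K\<^sup>K\<close> parities, which is superpolynomial in \<open>n\<close> as
  \<open>u\<close> grows.\<close>

section \<open>Statistical queries against orthogonal labellings\<close>

definition labelled_pmf :: "'x set \<Rightarrow> ('x \<Rightarrow> int list) \<Rightarrow> ('x \<Rightarrow> int) \<Rightarrow> (int list \<times> int) pmf" where
  "labelled_pmf X \<phi> f = map_pmf (\<lambda>x. (\<phi> x, f x)) (pmf_of_set X)"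

definition random_label_pmf :: "'x set \<Rightarrow> ('x \<Rightarrow> int list) \<Rightarrow> (int list \<times> int) pmf" where
  "random_label_pmf X \<phi> = map_pmf (\<lambda>(x, y). (\<phi> x, y)) (pmf_of_set (X \<times> {-1, 1}))"

text \<open>The residual of \<open>g\<close> after orthogonal projection onto the span of the
  \<open>\<psi> i\<close> has nonnegative squared norm. The projection coefficients are
  \<open>c i\<close>, and both the cross term and the square reduce to \<open>N\<close> times their
  sum of squares.\<close>

lemma bessel_inequality:
  fixes g :: "'x \<Rightarrow> real" and \<psi> :: "'i \<Rightarrow> 'x \<Rightarrow> real"
  assumes "finite J"
    and norm: "\<And>i. i \<in> J \<Longrightarrow> (\<Sum>x\<in>X. \<psi> i x * \<psi> i x) = N"
    and orth: "\<And>i j. i \<in> J \<Longrightarrow> j \<in> J \<Longrightarrow> i \<noteq> j \<Longrightarrow> (\<Sum>x\<in>X. \<psi> i x * \<psi> j x) = 0"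
    and "N > 0"
  shows "(\<Sum>i\<in>J. (\<Sum>x\<in>X. g x * \<psi> i x)\<^sup>2) \<le> N * (\<Sum>x\<in>X. (g x)\<^sup>2)"
proof -
  define c where "c i = (\<Sum>x\<in>X. g x * \<psi> i x) / N" for i
  have gc: "(\<Sum>x\<in>X. g x * \<psi> i x) = N * c i" for i
    using \<open>N > 0\<close> by (simp add: c_def)
  have cross: "(\<Sum>x\<in>X. g x * (\<Sum>i\<in>J. c i * \<psi> i x)) = N * (\<Sum>i\<in>J. (c i)\<^sup>2)"
  proof -
    have "(\<Sum>x\<in>X. g x * (\<Sum>i\<in>J. c i * \<psi> i x)) = (\<Sum>x\<in>X. \<Sum>i\<in>J. c i * (g x * \<psi> i x))"
      by (simp add: sum_distrib_left mult_ac)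
    also have "\<dots> = (\<Sum>i\<in>J. c i * (\<Sum>x\<in>X. g x * \<psi> i x))"
      by (subst sum.swap) (simp add: sum_distrib_left)
    finally show ?thesis
      by (simp add: gc sum_distrib_left power2_eq_square mult_ac)
  qed
  have square: "(\<Sum>x\<in>X. (\<Sum>i\<in>J. c i * \<psi> i x)\<^sup>2) = N * (\<Sum>i\<in>J. (c i)\<^sup>2)"
  proof -
    have "(\<Sum>x\<in>X. (\<Sum>i\<in>J. c i * \<psi> i x)\<^sup>2)
        = (\<Sum>x\<in>X. \<Sum>i\<in>J. \<Sum>j\<in>J. c i * c j * (\<psi> i x * \<psi> j x))"
      by (simp add: power2_eq_square sum_product mult_ac)
    also have "\<dots> = (\<Sum>i\<in>J. \<Sum>j\<in>J. c i * c j * (\<Sum>x\<in>X. \<psi> i x * \<psi> j x))"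
      by (subst sum.swap, rule sum.cong[OF refl], subst sum.swap) (simp add: sum_distrib_left)
    also have "\<dots> = (\<Sum>i\<in>J. \<Sum>j\<in>J. if j = i then N * (c i)\<^sup>2 else 0)"
      by (intro sum.cong refl) (auto simp: norm orth power2_eq_square)
    finally show ?thesis
      using \<open>finite J\<close> by (simp add: sum_distrib_left)
  qed
  have "0 \<le> (\<Sum>x\<in>X. (g x - (\<Sum>i\<in>J. c i * \<psi> i x))\<^sup>2)"
    by (intro sum_nonneg) simp
  also have "\<dots> = (\<Sum>x\<in>X. (g x)\<^sup>2) - N * (\<Sum>i\<in>J. (c i)\<^sup>2)"
    using cross square
    by (simp add: power2_diff sum.distrib sum_subtractf flip: sum_distrib_left)
       (simp add: mult.assoc flip: sum_distrib_left)
  finally have "N * (N * (\<Sum>i\<in>J. (c i)\<^sup>2)) \<le> N * (\<Sum>x\<in>X. (g x)\<^sup>2)"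
    using \<open>N > 0\<close> by (intro mult_left_mono) auto
  moreover have "(\<Sum>i\<in>J. (\<Sum>x\<in>X. g x * \<psi> i x)\<^sup>2) = N * (N * (\<Sum>i\<in>J. (c i)\<^sup>2))"
    by (simp add: gc power_mult_distrib sum_distrib_left power2_eq_square mult_ac)
  ultimately show ?thesis by simp
qed

text \<open>\<open>\<phi>\<close> is a feature map: queries and hypotheses see a point
  \<open>x\<close> only through \<open>\<phi> x\<close>, while labels are computed from
  \<open>x\<close> itself.\<close>

locale orthogonal_labels =
  fixes n :: nat and X :: "'x set" and \<phi> :: "'x \<Rightarrow> int list"
    and I :: "'i set" and \<psi> :: "'i \<Rightarrow> 'x \<Rightarrow> int"
  assumes fin_X: "finite X" and ne_X: "X \<noteq> {}" and fin_I: "finite I"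
    and phi: "\<And>x. x \<in> X \<Longrightarrow> \<phi> x \<in> sign_vectors n"
    and sign: "\<And>i x. i \<in> I \<Longrightarrow> x \<in> X \<Longrightarrow> \<psi> i x \<in> {-1, 1}"
    and orth: "\<And>i j. i \<in> I \<Longrightarrow> j \<in> I \<Longrightarrow> i \<noteq> j \<Longrightarrow> (\<Sum>x\<in>X. \<psi> i x * \<psi> j x) = 0"
begin

abbreviation "D \<equiv> \<lambda>i. labelled_pmf X \<phi> (\<psi> i)"
abbreviation "D0 \<equiv> random_label_pmf X \<phi>"

lemma card_X_pos: "real (card X) > 0"
  using fin_X ne_X by (simp add: card_gt_0_iff)

lemma D_distributions: "i \<in> I \<Longrightarrow> D i \<in> distributions n"
  using phi sign fin_X ne_X by (auto simp: labelled_pmf_def distributions_def examples_def)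

lemma D0_distributions: "D0 \<in> distributions n"
  using phi fin_X ne_X by (auto simp: random_label_pmf_def distributions_def examples_def)

lemma expectation_D:
  "measure_pmf.expectation (D i) f = (\<Sum>x\<in>X. f (\<phi> x, \<psi> i x)) / real (card X)"
  using fin_X ne_X by (simp add: labelled_pmf_def integral_pmf_of_set)

lemma expectation_D0:
  "measure_pmf.expectation D0 f
     = (\<Sum>x\<in>X. f (\<phi> x, -1) + f (\<phi> x, 1)) / (2 * real (card X))"
  using fin_X ne_X
  by (simp add: random_label_pmf_def integral_pmf_of_set card_cartesian_product
      sum.cartesian_product' split_def algebra_simps)

text \<open>Each counted index contributes at least \<open>(card X / T)^2\<close> to the sum in
  Bessel's inequality, which is at most \<open>(card X)^2\<close>.\<close>

lemma few_correlated:
  fixes g :: "'x \<Rightarrow> real"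
  assumes g: "\<And>x. x \<in> X \<Longrightarrow> \<bar>g x\<bar> \<le> 1" and "T > 0"
  shows "real (card {i \<in> I. \<bar>\<Sum>x\<in>X. g x * \<psi> i x\<bar> \<ge> card X / T}) \<le> T\<^sup>2"
proof -
  define N where "N = real (card X)"
  define J where "J = {i \<in> I. \<bar>\<Sum>x\<in>X. g x * \<psi> i x\<bar> \<ge> N / T}"
  have N: "N > 0" using card_X_pos by (simp add: N_def)
  have "real (card J) * (N / T)\<^sup>2 = (\<Sum>i\<in>J. (N / T)\<^sup>2)" by simp
  also have "\<dots> \<le> (\<Sum>i\<in>J. (\<Sum>x\<in>X. g x * \<psi> i x)\<^sup>2)"
    using N \<open>T > 0\<close> by (intro sum_mono) (auto simp: J_def abs_le_square_iff[symmetric])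
  also have "\<dots> \<le> N * (\<Sum>x\<in>X. (g x)\<^sup>2)"
  proof (rule bessel_inequality)
    show "finite J" using fin_I by (simp add: J_def)
    show "N > 0" by (fact N)
    fix i assume i: "i \<in> J"
    have "\<psi> i x * \<psi> i x = 1" if "x \<in> X" for x
      using sign[of i x] i that by (auto simp: J_def)
    then show "(\<Sum>x\<in>X. real_of_int (\<psi> i x) * real_of_int (\<psi> i x)) = N"
      by (simp add: N_def flip: of_int_mult)
    fix j assume "j \<in> J" "i \<noteq> j"
    then show "(\<Sum>x\<in>X. real_of_int (\<psi> i x) * real_of_int (\<psi> j x)) = 0"
      using orth[of i j] i by (simp add: J_def flip: of_int_mult of_int_sum)
  qed
  also have "\<dots> \<le> N * (\<Sum>x\<in>X. 1)"
    using g N by (intro mult_left_mono sum_mono) (auto simp: abs_square_le_1)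
  finally have "real (card J) * (N\<^sup>2 / T\<^sup>2) \<le> N\<^sup>2"
    by (simp add: N_def power2_eq_square power_divide)
  then show ?thesis
    using N \<open>T > 0\<close> by (simp add: J_def N_def field_simps)
qed

text \<open>\<open>D i\<close> and \<open>D0\<close> agree on the features, so only the
  label-dependent half \<open>g\<close> of the query matters: the two expectations differ by the
  normalized correlation of \<open>g\<close> with \<open>\<psi> i\<close>.\<close>

lemma few_distinguished:
  assumes Q: "Q ` examples n \<subseteq> {-1, 1}" and "T > 0"
  shows "real (card {i \<in> I. \<bar>measure_pmf.expectation (D i) (\<lambda>z. real_of_int (Q z))
            - measure_pmf.expectation D0 (\<lambda>z. real_of_int (Q z))\<bar> \<ge> 1 / T}) \<le> T\<^sup>2"
proof -
  define g :: "'x \<Rightarrow> real" where "g x = (Q (\<phi> x, 1) - Q (\<phi> x, -1)) / 2" for x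
  have Qx: "Q (\<phi> x, 1) \<in> {-1, 1}" "Q (\<phi> x, -1) \<in> {-1, 1}" if "x \<in> X" for x
    using Q phi[OF that] by (auto simp: examples_def)
  have g: "\<bar>g x\<bar> \<le> 1" if "x \<in> X" for x
    using Qx[OF that] by (auto simp: g_def)
  have diff: "measure_pmf.expectation (D i) (\<lambda>z. real_of_int (Q z))
      - measure_pmf.expectation D0 (\<lambda>z. real_of_int (Q z)) = (\<Sum>x\<in>X. g x * \<psi> i x) / card X"
    if "i \<in> I" for i
  proof -
    have "(\<Sum>x\<in>X. g x * \<psi> i x) = (\<Sum>x\<in>X. Q (\<phi> x, \<psi> i x) - (Q (\<phi> x, -1) + Q (\<phi> x, 1)) / 2)"
      using sign[OF that] by (intro sum.cong refl) (force simp: g_def field_simps)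
    then show ?thesis
      unfolding expectation_D expectation_D0
      by (simp add: sum_subtractf diff_divide_distrib flip: sum_divide_distrib)
  qed
  have "{i \<in> I. \<bar>measure_pmf.expectation (D i) (\<lambda>z. real_of_int (Q z))
            - measure_pmf.expectation D0 (\<lambda>z. real_of_int (Q z))\<bar> \<ge> 1 / T}
      = {i \<in> I. \<bar>\<Sum>x\<in>X. g x * \<psi> i x\<bar> \<ge> card X / T}"
    using card_X_pos \<open>T > 0\<close> by (auto simp: diff field_simps)
  then show ?thesis using few_correlated[OF g \<open>T > 0\<close>] by simp
qed

text \<open>The error is 1/2 minus half the normalized correlation of the hypothesis with the
  labels, so an advantage \<gamma> means a correlation of at least 2\<gamma>.\<close>

lemma few_well_predicted:
  assumes h: "h ` sign_vectors n \<subseteq> {-1, 1}" and "\<gamma> > 0"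
  shows "real (card {i \<in> I. Err (D i) h \<le> 1 / 2 - \<gamma>}) \<le> (1 / (2 * \<gamma>))\<^sup>2"
proof -
  have err: "Err (D i) h = 1 / 2 - (\<Sum>x\<in>X. real_of_int (h (\<phi> x)) * \<psi> i x) / (2 * card X)"
    if "i \<in> I" for i
  proof -
    have "Err (D i) h = measure_pmf.expectation (D i) (indicator {(x, y). h x \<noteq> y})"
      by (simp add: Err_def)
    also have "\<dots> = (\<Sum>x\<in>X. indicator {(x, y). h x \<noteq> y} (\<phi> x, \<psi> i x)) / card X"
      by (rule expectation_D)
    also have "(\<Sum>x\<in>X. indicator {(x, y). h x \<noteq> y} (\<phi> x, \<psi> i x))
        = (\<Sum>x\<in>X. 1 / 2 - real_of_int (h (\<phi> x)) * \<psi> i x / 2)"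
    proof (intro sum.cong refl)
      fix x assume "x \<in> X"
      then have "h (\<phi> x) \<in> {-1, 1}" "\<psi> i x \<in> {-1, 1}"
        using h phi sign[OF that] by auto
      then show "indicator {(x, y). h x \<noteq> y} (\<phi> x, \<psi> i x) = 1 / 2 - real_of_int (h (\<phi> x)) * \<psi> i x / 2"
        by (auto simp: indicator_def)
    qed
    finally show ?thesis
      using card_X_pos by (simp add: sum_subtractf diff_divide_distrib flip: sum_divide_distrib)
  qed
  have "{i \<in> I. Err (D i) h \<le> 1 / 2 - \<gamma>}
      \<subseteq> {i \<in> I. \<bar>\<Sum>x\<in>X. real_of_int (h (\<phi> x)) * \<psi> i x\<bar> \<ge> card X / (1 / (2 * \<gamma>))}"
    using card_X_pos by (auto simp: err field_simps)
  then have "card {i \<in> I. Err (D i) h \<le> 1 / 2 - \<gamma>}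
      \<le> card {i \<in> I. \<bar>\<Sum>x\<in>X. real_of_int (h (\<phi> x)) * \<psi> i x\<bar> \<ge> card X / (1 / (2 * \<gamma>))}"
    using fin_I by (intro card_mono) auto
  also have "real \<dots> \<le> (1 / (2 * \<gamma>))\<^sup>2"
  proof (rule few_correlated)
    fix x assume "x \<in> X"
    then have "h (\<phi> x) \<in> {-1, 1}" using h phi by auto
    then show "\<bar>real_of_int (h (\<phi> x))\<bar> \<le> 1" by auto
  qed (use \<open>\<gamma> > 0\<close> in simp)
  finally show ?thesis by simp
qed

text \<open>The adversarial oracle. Its answers do not mention \<open>i\<close>, so a single
  transcript serves for all labellings that tolerate it.\<close>

definition exact_run :: "sq_algorithm \<Rightarrow> rat list \<Rightarrow> bool" where
  "exact_run A as \<longleftrightarrow> (\<forall>i < length as. \<exists>Q \<tau>. A n (take i as) = Query Q \<tau> \<and>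
     of_rat (as ! i) = measure_pmf.expectation D0 (\<lambda>z. real_of_int (Q z)))"

text \<open>Answers have type \<open>rat\<close>, so the exact expectation must be shown to be an
  admissible answer.\<close>

lemma rational_expectation:
  "\<exists>r. of_rat r = measure_pmf.expectation D0 (\<lambda>z. real_of_int (Q z))"
proof
  show "of_rat (of_int (\<Sum>x\<in>X. Q (\<phi> x, -1) + Q (\<phi> x, 1)) / of_nat (2 * card X))
      = measure_pmf.expectation D0 (\<lambda>z. real_of_int (Q z))"
    unfolding expectation_D0 of_rat_divide of_rat_of_int_eq of_rat_of_nat_eq by simp
qed

lemma take_exact_run: "exact_run A as \<Longrightarrow> exact_run A (take k as)"
  by (auto simp: exact_run_def min_def)

context
  fixes A :: sq_algorithm and q T :: real
  assumes legal: "legal_sq_algorithm A"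
    and queries: "\<And>as. sq_run A n D0 as \<Longrightarrow> real (length as) \<le> q"
    and tol: "\<And>as Q \<tau>. sq_run A n D0 as \<Longrightarrow> A n as = Query Q \<tau> \<Longrightarrow> 1 / of_rat \<tau> \<le> T"
    and "T > 0"
begin

text \<open>An exact answer is within the tolerance as soon as the tolerance is positive. Positivity
  comes from legality, which is only known along runs, hence the induction on the length.\<close>

lemma exact_run_legal:
  assumes "exact_run A as"
  shows "sq_run A n D0 as" "legal_move n (A n as)"
proof -
  have "sq_run A n D0 as" using assms
  proof (induction "length as" arbitrary: as)
    case 0
    then show ?case by (simp add: sq_run_def)
  next
    case (Suc k)
    have run: "sq_run A n D0 (take k as)"
      using Suc by (intro Suc) (auto intro: take_exact_run)
    show ?case
      unfolding sq_run_def
    proof (intro allI impI)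
      fix i assume i: "i < length as"
      from Suc.prems i obtain Q \<tau> where Q: "A n (take i as) = Query Q \<tau>"
        "of_rat (as ! i) = measure_pmf.expectation D0 (\<lambda>z. real_of_int (Q z))"
        by (auto simp: exact_run_def)
      have "sq_run A n D0 (take i as)"
        using run i Suc.hyps by (auto simp: sq_run_def min_def)
      then have "legal_move n (A n (take i as))"
        using legal D0_distributions by (auto simp: legal_sq_algorithm_def)
      then have "\<tau> > 0" by (simp add: Q)
      then show "\<exists>Q \<tau>. A n (take i as) = Query Q \<tau> \<and>
          \<bar>measure_pmf.expectation D0 (\<lambda>z. real_of_int (Q z)) - of_rat (as ! i)\<bar> \<le> of_rat \<tau>"
        using Q by (intro exI[of _ Q] exI[of _ \<tau>]) auto
    qed
  qed
  then show "sq_run A n D0 as" "legal_move n (A n as)"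
    using legal D0_distributions by (auto simp: legal_sq_algorithm_def)
qed

text \<open>Otherwise exact runs could be extended forever, past the query bound
  \<open>q\<close>.\<close>

lemma exact_run_terminates: "\<exists>as h. exact_run A as \<and> A n as = Output h"
proof (rule ccontr)
  assume no: "\<nexists>as h. exact_run A as \<and> A n as = Output h"
  have "\<exists>as. length as = k \<and> exact_run A as" for k
  proof (induction k)
    case 0
    show ?case by (simp add: exact_run_def)
  next
    case (Suc k)
    then obtain as where as: "length as = k" "exact_run A as" by auto
    with no obtain Q \<tau> where Q: "A n as = Query Q \<tau>" by (cases "A n as") auto
    obtain r where "of_rat r = measure_pmf.expectation D0 (\<lambda>z. real_of_int (Q z))"
      using rational_expectation by blast
    with as Q have "exact_run A (as @ [r])"
      by (auto simp: exact_run_def nth_append less_Suc_eq)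
    with as show ?case by (intro exI[of _ "as @ [r]"]) simp
  qed
  then obtain as where "length as = Suc (nat \<lceil>q\<rceil>)" "exact_run A as" by blast
  with queries[of as] exact_run_legal(1)[of as] show False by linarith
qed

text \<open>Union bound over the queries: if \<open>as\<close> is no run on \<open>D i\<close>, some
  answer is off by more than its tolerance, which is at least \<open>1 / T\<close>; each query has
  at most \<open>T^2\<close> such indices.\<close>

lemma few_excluded:
  assumes "exact_run A as"
  shows "real (card {i \<in> I. \<not> sq_run A n (D i) as}) \<le> q * T\<^sup>2"
proof -
  define Q where "Q k = query_fun (A n (take k as))" for k
  define J where "J k = {i \<in> I. \<bar>measure_pmf.expectation (D i) (\<lambda>z. real_of_int (Q k z))
            - measure_pmf.expectation D0 (\<lambda>z. real_of_int (Q k z))\<bar> \<ge> 1 / T}" for k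
  have query: "\<exists>\<tau>. A n (take k as) = Query (Q k) \<tau> \<and> 1 / T \<le> of_rat \<tau> \<and>
      of_rat (as ! k) = measure_pmf.expectation D0 (\<lambda>z. real_of_int (Q k z)) \<and>
      Q k ` examples n \<subseteq> {-1, 1}" if k: "k < length as" for k
  proof -
    obtain Q' \<tau> where Q': "A n (take k as) = Query Q' \<tau>"
      "of_rat (as ! k) = measure_pmf.expectation D0 (\<lambda>z. real_of_int (Q' z))"
      using assms k unfolding exact_run_def by blast
    then have "Q' = Q k" by (simp add: Q_def)
    note \<tau> = Q'[unfolded this]
    have ex: "exact_run A (take k as)" using assms by (rule take_exact_run)
    have 1: "Q k ` examples n \<subseteq> {-1, 1}" "\<tau> > 0"
      using exact_run_legal(2)[OF ex] \<tau> by auto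
    have "1 / of_rat \<tau> \<le> T" using tol[OF exact_run_legal(1)[OF ex] \<tau>(1)] .
    then have "1 / T \<le> of_rat \<tau>" using 1 \<open>T > 0\<close> by (simp add: field_simps)
    with \<tau> 1 show ?thesis by blast
  qed
  have "{i \<in> I. \<not> sq_run A n (D i) as} \<subseteq> (\<Union>k<length as. J k)"
  proof
    fix i assume "i \<in> {i \<in> I. \<not> sq_run A n (D i) as}"
    then obtain k where i: "i \<in> I" and k: "k < length as"
      and far: "\<And>Q \<tau>. A n (take k as) = Query Q \<tau> \<Longrightarrow>
        \<not> \<bar>measure_pmf.expectation (D i) (\<lambda>z. real_of_int (Q z)) - of_rat (as ! k)\<bar> \<le> of_rat \<tau>"
      unfolding sq_run_def by blast
    with query[OF k] have "i \<in> J k" by (fastforce simp: J_def)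
    with k show "i \<in> (\<Union>k<length as. J k)" by blast
  qed
  then have "card {i \<in> I. \<not> sq_run A n (D i) as} \<le> card (\<Union>k<length as. J k)"
    using fin_I by (intro card_mono) (auto simp: J_def)
  also have "\<dots> \<le> (\<Sum>k<length as. card (J k))"
    by (rule card_UN_le) simp
  finally have "real (card {i \<in> I. \<not> sq_run A n (D i) as}) \<le> (\<Sum>k<length as. real (card (J k)))"
    by (simp flip: of_nat_sum)
  also have "\<dots> \<le> (\<Sum>k<length as. T\<^sup>2)"
    unfolding J_def using query \<open>T > 0\<close> by (intro sum_mono few_distinguished) auto
  also have "\<dots> \<le> q * T\<^sup>2"
    using queries[OF exact_run_legal(1)[OF assms]] by (simp add: mult_right_mono)
  finally show ?thesis .
qed

text \<open>The excluded and the well-predicted indices together do not exhaust \<open>I\<close>.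
  For a remaining index the exact transcript is a valid run, and its hypothesis does poorly.\<close>

lemma fooled:
  assumes "\<gamma> > 0" and many: "real (card I) > q * T\<^sup>2 + (1 / (2 * \<gamma>))\<^sup>2"
  shows "\<exists>i\<in>I. \<exists>as h. sq_run A n (D i) as \<and> A n as = Output h \<and> Err (D i) h > 1 / 2 - \<gamma>"
proof -
  obtain as h where as: "exact_run A as" and h: "A n as = Output h"
    using exact_run_terminates by blast
  have hs: "h ` sign_vectors n \<subseteq> {-1, 1}"
    using exact_run_legal(2)[OF as] h by simp
  let ?P = "{i \<in> I. \<not> sq_run A n (D i) as}" and ?R = "{i \<in> I. Err (D i) h \<le> 1 / 2 - \<gamma>}"
  have "real (card (?P \<union> ?R)) \<le> real (card ?P) + real (card ?R)"
    using card_Un_le[of ?P ?R] by linarith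
  also have "\<dots> < card I"
    using few_excluded[OF as] few_well_predicted[OF hs \<open>\<gamma> > 0\<close>] many by linarith
  finally have "\<not> I \<subseteq> ?P \<union> ?R"
    using card_mono[of "?P \<union> ?R" I] fin_I by auto
  with h show ?thesis by fastforce
qed

end
end

section \<open>Sparse parities\<close>

definition cube :: "nat \<Rightarrow> (nat \<Rightarrow> int) set" where
  "cube m = {..<m} \<rightarrow>\<^sub>E {-1, 1}"

definition parity :: "nat set \<Rightarrow> (nat \<Rightarrow> int) \<Rightarrow> int" where
  "parity S x = (\<Prod>i\<in>S. x i)"

lemma finite_cube: "finite (cube m)"
  by (simp add: cube_def finite_PiE)

lemma card_cube: "card (cube m) = 2 ^ m"
  by (simp add: cube_def card_PiE numeral_2_eq_2)

lemma cube_sign: "x \<in> cube m \<Longrightarrow> i < m \<Longrightarrow> x i \<in> {-1, 1}"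
  by (auto simp: cube_def PiE_def Pi_def)

lemma prod_signs: "(\<And>i. i \<in> S \<Longrightarrow> f i \<in> {-1, 1}) \<Longrightarrow> (\<Prod>i\<in>S. f i) \<in> {-1, 1 :: int}"
proof (induction S rule: infinite_finite_induct)
  case (insert i S)
  then have "f i = -1 \<or> f i = 1" "(\<Prod>i\<in>S. f i) = -1 \<or> (\<Prod>i\<in>S. f i) = 1"
    by blast+
  with insert.hyps show ?case by auto
qed auto

lemma parity_sign: "x \<in> cube m \<Longrightarrow> S \<subseteq> {..<m} \<Longrightarrow> parity S x \<in> {-1, 1}"
  unfolding parity_def by (rule prod_signs) (use cube_sign in blast)

text \<open>Independence of the coordinates in product form; it serves both orthogonality and the
  moment generating function.\<close>

lemma sum_prod_cube:
  fixes f :: "nat \<Rightarrow> int \<Rightarrow> 'a :: comm_semiring_1"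
  shows "(\<Sum>x\<in>cube m. \<Prod>i<m. f i (x i)) = (\<Prod>i<m. f i (-1) + f i 1)"
proof -
  have "(\<Prod>i<m. f i (-1) + f i 1) = (\<Prod>i<m. \<Sum>y\<in>{-1, 1}. f i y)" by simp
  also have "\<dots> = (\<Sum>x\<in>cube m. \<Prod>i<m. f i (x i))"
    unfolding cube_def by (rule prod_sum_PiE) auto
  finally show ?thesis by simp
qed

lemma prod_subset_conv_if:
  "S \<subseteq> {..<m::nat} \<Longrightarrow> (\<Prod>i\<in>S. f i) = (\<Prod>i<m. if i \<in> S then f i else 1)"
  by (simp add: prod.If_cases Int_absorb1)

text \<open>At a coordinate in the symmetric difference of \<open>S\<close> and \<open>T\<close> the
  factor is \<open>-1 + 1 = 0\<close>.\<close>

lemma parity_orthogonal: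
  assumes "S \<subseteq> {..<m}" "T \<subseteq> {..<m}" "S \<noteq> T"
  shows "(\<Sum>x\<in>cube m. parity S x * parity T x) = 0"
proof -
  define f :: "nat \<Rightarrow> int \<Rightarrow> int" where
    "f i v = (if i \<in> S then v else 1) * (if i \<in> T then v else 1)" for i v
  have "(\<Sum>x\<in>cube m. parity S x * parity T x) = (\<Sum>x\<in>cube m. \<Prod>i<m. f i (x i))"
    unfolding parity_def prod_subset_conv_if[OF assms(1)] prod_subset_conv_if[OF assms(2)] f_def
    by (simp only: prod.distrib)
  also have "\<dots> = (\<Prod>i<m. f i (-1) + f i 1)" by (rule sum_prod_cube)
  also have "\<dots> = 0"
  proof -
    obtain i where "i \<in> S \<union> T" "i \<notin> S \<inter> T" using \<open>S \<noteq> T\<close> by blast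
    then have "i < m" "f i (-1) + f i 1 = 0" using assms by (auto simp: f_def)
    then show ?thesis by (metis finite_lessThan lessThan_iff prod_zero)
  qed
  finally show ?thesis .
qed

section \<open>A Chernoff bound for the sum of the relevant bits\<close>

lemma exp_add_exp_minus_le:
  assumes "0 \<le> l" "l \<le> (1::real)"
  shows "exp l + exp (- l) \<le> 2 * exp (l\<^sup>2)"
proof -
  have "exp l \<le> 1 + l + l\<^sup>2" using assms by (rule exp_bound)
  moreover have "exp (- l) \<le> 1 - l + l\<^sup>2"
  proof -
    \<comment> \<open>The product equals \<open>1 + l^3\<close>.\<close>
    have "1 \<le> (1 - l + l\<^sup>2) * (1 + l)"
      using assms by (simp add: algebra_simps power2_eq_square)
    also have "\<dots> \<le> (1 - l + l\<^sup>2) * exp l"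
      using assms by (intro mult_left_mono exp_ge_add_one_self)
        (simp add: add_nonneg_nonneg)
    finally show ?thesis by (simp add: exp_minus field_simps)
  qed
  moreover have "1 + l\<^sup>2 \<le> exp (l\<^sup>2)" by (rule exp_ge_add_one_self)
  ultimately show ?thesis by linarith
qed

text \<open>The moment generating function factorizes: coordinates outside \<open>S\<close>
  contribute 2, those in \<open>S\<close> at most \<open>2 * exp (l^2)\<close>.\<close>

lemma sum_exp_cube:
  fixes l :: real
  assumes "S \<subseteq> {..<m}" "\<bar>l\<bar> \<le> 1"
  shows "(\<Sum>x\<in>cube m. exp (l * (\<Sum>i\<in>S. x i))) \<le> 2 ^ m * exp (l\<^sup>2 * card S)"
proof -
  have fin: "finite S" using assms finite_subset by blast
  define f :: "nat \<Rightarrow> int \<Rightarrow> real" where "f i v = (if i \<in> S then exp (l * v) else 1)" for i v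
  have "(\<Sum>x\<in>cube m. exp (l * (\<Sum>i\<in>S. x i))) = (\<Sum>x\<in>cube m. \<Prod>i<m. f i (x i))"
    using fin by (simp add: f_def sum_distrib_left exp_sum flip: prod_subset_conv_if[OF assms(1)])
  also have "\<dots> = (\<Prod>i<m. f i (-1) + f i 1)" by (rule sum_prod_cube)
  also have "\<dots> \<le> (\<Prod>i<m. 2 * (if i \<in> S then exp (l\<^sup>2) else 1))"
  proof (rule prod_mono, intro conjI)
    fix i
    show "0 \<le> f i (-1) + f i 1" by (simp add: f_def)
    show "f i (-1) + f i 1 \<le> 2 * (if i \<in> S then exp (l\<^sup>2) else 1)"
      using exp_add_exp_minus_le[of "\<bar>l\<bar>"] assms(2) by (auto simp: f_def abs_if split: if_splits)
  qed
  also have "\<dots> = 2 ^ m * exp (l\<^sup>2 * card S)"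
    by (simp add: prod.distrib exp_of_nat_mult mult.commute flip: prod_subset_conv_if[OF assms(1)])
  finally show ?thesis .
qed

text \<open>Exponential Markov inequality; adding the terms for \<open>l\<close> and
  \<open>- l\<close> covers both tails, whence the factor 2.\<close>

lemma sparse_sum_tail:
  fixes d :: real
  assumes "S \<subseteq> {..<m}" "0 \<le> d" "d \<le> card S"
  shows "real (card {x \<in> cube m. \<bar>real_of_int (\<Sum>i\<in>S. x i)\<bar> > d})
    \<le> 2 ^ m * (2 * exp (- d\<^sup>2 / (4 * real (card S))))"
proof (cases "card S = 0")
  case True
  then have "S = {}" using assms finite_subset by (simp add: card_eq_0_iff) blast
  with assms(2) show ?thesis by simp
next
  case False
  define K where "K = real (card S)"
  have K: "K > 0" using False by (simp add: K_def)
  \<comment> \<open>The minimizer of the exponent \<open>l^2 * K - l * d\<close>.\<close>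
  define l where "l = d / (2 * K)"
  have l: "0 \<le> l" "\<bar>l\<bar> \<le> 1" using assms K by (auto simp: l_def K_def field_simps)
  have expo: "l\<^sup>2 * K - l * d = - d\<^sup>2 / (4 * K)"
    using K by (simp add: l_def field_simps power2_eq_square)
  define s where "s x = real_of_int (\<Sum>i\<in>S. x i)" for x :: "nat \<Rightarrow> int"
  have "real (card {x \<in> cube m. \<bar>s x\<bar> > d}) = (\<Sum>x\<in>{x \<in> cube m. \<bar>s x\<bar> > d}. 1)" by simp
  also have "\<dots> \<le> (\<Sum>x\<in>{x \<in> cube m. \<bar>s x\<bar> > d}. exp (- (l * d)) * (exp (l * s x) + exp (- l * s x)))"
  proof (rule sum_mono)
    fix x assume "x \<in> {x \<in> cube m. \<bar>s x\<bar> > d}"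
    then have "l * d \<le> l * \<bar>s x\<bar>" using l by (intro mult_left_mono) auto
    then have "1 \<le> exp (- (l * d)) * exp (l * \<bar>s x\<bar>)" by (simp flip: exp_add)
    also have "\<dots> \<le> exp (- (l * d)) * (exp (l * s x) + exp (- l * s x))"
      by (intro mult_left_mono) (auto simp: abs_if)
    finally show "1 \<le> exp (- (l * d)) * (exp (l * s x) + exp (- l * s x))" .
  qed
  also have "\<dots> \<le> (\<Sum>x\<in>cube m. exp (- (l * d)) * (exp (l * s x) + exp (- l * s x)))"
    by (intro sum_mono2 finite_cube) (auto intro: add_nonneg_nonneg)
  also have "\<dots> = exp (- (l * d)) * ((\<Sum>x\<in>cube m. exp (l * s x)) + (\<Sum>x\<in>cube m. exp (- l * s x)))"
    by (simp add: sum.distrib flip: sum_distrib_left)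
  also have "\<dots> \<le> exp (- (l * d)) * (2 ^ m * exp (l\<^sup>2 * K) + 2 ^ m * exp (l\<^sup>2 * K))"
    using sum_exp_cube[OF assms(1), of l] sum_exp_cube[OF assms(1), of "- l"] l
    by (intro mult_left_mono add_mono) (auto simp: s_def K_def)
  also have "\<dots> = 2 ^ m * (2 * exp (l\<^sup>2 * K - l * d))"
    by (simp add: exp_diff exp_minus field_simps)
  finally show ?thesis unfolding expo unfolding s_def K_def .
qed

section \<open>Parities as low-degree threshold functions\<close>

text \<open>\<open>N\<close> is the number of indices with \<open>x i = -1\<close>.\<close>

lemma signs_sum_prod:
  assumes "finite S" "\<And>i. i \<in> S \<Longrightarrow> x i \<in> {-1, 1 :: int}"
  shows "\<exists>N. (\<Sum>i\<in>S. x i) = int (card S) - 2 * int N \<and> (\<Prod>i\<in>S. x i) = (- 1) ^ N"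
  using assms
proof (induction S rule: finite_induct)
  case empty
  show ?case by (intro exI[of _ 0]) simp
next
  case (insert i S)
  then obtain N where "(\<Sum>i\<in>S. x i) = int (card S) - 2 * int N" "(\<Prod>i\<in>S. x i) = (- 1) ^ N"
    by auto
  moreover have "x i = -1 \<or> x i = 1" using insert.prems by blast
  ultimately show ?case
    using insert.hyps by (elim disjE; intro exI[of _ "if x i = 1 then N else Suc N"]) auto
qed

text \<open>The polynomial with the odd numbers between \<open>-2c\<close> and \<open>2c\<close> as its roots changes
  sign exactly where the parity does.\<close>

lemma parity_sign_polynomial:
  assumes "finite S" "\<And>i. i \<in> S \<Longrightarrow> x i \<in> {-1, 1 :: int}" and card: "card S = 2 * k"
    and small: "\<bar>\<Sum>i\<in>S. x i\<bar> \<le> 2 * int c"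
  shows "1 \<le> (\<Prod>i\<in>S. x i) * ((-1) ^ (k + c) * (\<Prod>j<2 * c. (\<Sum>i\<in>S. x i) - (2 * int j + 1 - 2 * int c)))"
proof -
  obtain N where N: "(\<Sum>i\<in>S. x i) = 2 * int k - 2 * int N" "(\<Prod>i\<in>S. x i) = (- 1) ^ N"
    using signs_sum_prod[of S x, OF assms(1,2)] card by auto
  \<comment> \<open>The number of roots below the sum: factor \<open>j\<close> becomes
    \<open>2 * (l - j) - 1\<close>, positive exactly for \<open>j < l\<close>. Smallness of the sum
    gives \<open>N \<le> k + c\<close>, so the subtraction is not truncated.\<close>
  define l where "l = k + c - N"
  have l: "int l = int k + int c - int N" "l \<le> 2 * c"
    using small N by (auto simp: l_def)
  have "(\<Prod>j<2 * c. (\<Sum>i\<in>S. x i) - (2 * int j + 1 - 2 * int c))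
      = (\<Prod>j<2 * c. 2 * (int l - int j) - 1)"
    using l N by (intro prod.cong refl) auto
  \<comment> \<open>Since \<open>N + l = k + c\<close>, both sides have the parity of
    \<open>l\<close>. The sign can thus be distributed over the factors, turning each into a
    positive odd integer.\<close>
  moreover have "(- 1) ^ N * (-1) ^ (k + c) = (\<Prod>j<2 * c. if j < l then 1 else -1 :: int)"
  proof -
    have "{..<2 * c} \<inter> - {j. j < l} = {l..<2 * c}" by auto
    then have "(\<Prod>j<2 * c. if j < l then 1 else -1 :: int) = (- 1) ^ (2 * c - l)"
      by (simp add: prod.If_cases)
    moreover have "N + l = k + c" using l(1) by presburger
    then have "N + (k + c) + l = 2 * (k + c)" by simp
    moreover have "2 * c - l + l = 2 * c" using l(2) by simp
    ultimately show ?thesis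
      by (metis (no_types, lifting) even_add even_mult_iff even_numeral minus_one_power_iff power_add)
  qed
  ultimately have "(\<Prod>i\<in>S. x i) * ((-1) ^ (k + c) * (\<Prod>j<2 * c. (\<Sum>i\<in>S. x i) - (2 * int j + 1 - 2 * int c)))
      = (\<Prod>j<2 * c. (if j < l then 1 else -1) * (2 * (int l - int j) - 1))"
    unfolding prod.distrib using N by (simp add: mult_ac)
  also have "\<dots> \<ge> 1"
    by (rule prod_ge_1) auto
  finally show ?thesis .
qed

text \<open>Coordinate \<open>m\<close> stands for the constant 1, so the exponent vectors \<open>f\<close> also describe the
  monomials of degree less than \<open>d\<close>.\<close>

definition monomial :: "nat \<Rightarrow> nat \<Rightarrow> (nat \<Rightarrow> int) \<Rightarrow> (nat \<Rightarrow> nat) \<Rightarrow> int" where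
  "monomial m d x f = (\<Prod>j<d. if f j < m then x (f j) else 1)"

text \<open>Factors are chosen in order, so a monomial recurs under rearrangement. Expanding a
  product of affine forms then needs no multinomial coefficients.\<close>

definition exponents :: "nat \<Rightarrow> nat \<Rightarrow> (nat \<Rightarrow> nat) set" where
  "exponents m d = {..<d} \<rightarrow>\<^sub>E {..m}"

lemma finite_exponents: "finite (exponents m d)"
  by (simp add: exponents_def finite_PiE)

lemma card_exponents: "card (exponents m d) = (m + 1) ^ d"
  by (simp add: exponents_def card_PiE)

lemma monomial_sign: "x \<in> cube m \<Longrightarrow> monomial m d x f \<in> {-1, 1}"
  unfolding monomial_def by (rule prod_signs) (use cube_sign in auto)

text \<open>Distributivity: \<open>f\<close> picks one summand from each affine form, with index
  \<open>m\<close> for the constant term.\<close>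

lemma prod_affine_eq_monomials:
  fixes a :: "nat \<Rightarrow> nat \<Rightarrow> real"
  shows "(\<Prod>j<d. (\<Sum>i<m. a j i * x i) + a j m)
    = (\<Sum>f\<in>exponents m d. (\<Prod>j<d. a j (f j)) * monomial m d x f)"
proof -
  have "(\<Prod>j<d. (\<Sum>i<m. a j i * x i) + a j m)
      = (\<Prod>j<d. \<Sum>i\<le>m. a j i * (if i < m then x i else 1))"
    by (simp flip: lessThan_Suc_atMost)
  also have "\<dots> = (\<Sum>f\<in>exponents m d. \<Prod>j<d. a j (f j) * (if f j < m then x (f j) else 1))"
    unfolding exponents_def by (rule prod_sum_PiE) auto
  also have "\<dots> = (\<Sum>f\<in>exponents m d. (\<Prod>j<d. a j (f j)) * monomial m d x f)"
    unfolding monomial_def of_int_prod prod.distrib[symmetric]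
    by (intro sum.cong prod.cong refl)
  finally show ?thesis .
qed

text \<open>As like terms are not collected, the 1-norm of the coefficients is exactly
  multiplicative.\<close>

lemma sum_abs_exponents:
  fixes a :: "nat \<Rightarrow> nat \<Rightarrow> real"
  shows "(\<Sum>f\<in>exponents m d. \<bar>\<Prod>j<d. a j (f j)\<bar>) = (\<Prod>j<d. \<Sum>i\<le>m. \<bar>a j i\<bar>)"
  unfolding exponents_def abs_prod by (rule prod_sum_PiE[symmetric]) auto

lemma parity_threshold:
  assumes S: "S \<subseteq> {..<m}" and card: "card S = 2 * k" and "c \<le> k" "4 * k \<le> m + 1"
  shows "\<exists>w. (\<Sum>f\<in>exponents m (2 * c). \<bar>w f\<bar>) \<le> 2 * real ((m + 1) ^ (2 * c)) \<and>
    (\<forall>x\<in>cube m. \<bar>\<Sum>i\<in>S. x i\<bar> \<le> 2 * int c \<longrightarrow>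
       (\<Sum>f\<in>exponents m (2 * c). w f * monomial m (2 * c) x f) * parity S x \<ge> (2::real))"
proof -
  have fin: "finite S" using S finite_subset by blast
  \<comment> \<open>The roots of the polynomial; \<open>a j\<close> then holds the coefficients of
    the affine form "sum over \<open>S\<close> minus \<open>r j\<close>".\<close>
  define r where "r j = 2 * real j + 1 - 2 * real c" for j
  define a where "a j i = (if i \<in> S then 1 else if i = m then - r j else 0)" for j i
  \<comment> \<open>The factor 2 lifts the guaranteed value from 1 to 2, because the margin has to
    exceed 1 strictly.\<close>
  define w where "w f = 2 * ((-1) ^ (k + c) * (\<Prod>j<2 * c. a j (f j)))" for f
  have m: "m \<notin> S" using S by auto
  show ?thesis
  proof (intro exI[of _ w] conjI ballI impI)
    have "(\<Sum>f\<in>exponents m (2 * c). \<bar>w f\<bar>) = 2 * (\<Sum>f\<in>exponents m (2 * c). \<bar>\<Prod>j<2 * c. a j (f j)\<bar>)"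
      by (simp add: w_def abs_mult power_abs sum_distrib_left)
    also have "\<dots> = 2 * (\<Prod>j<2 * c. \<Sum>i\<le>m. \<bar>a j i\<bar>)" by (simp only: sum_abs_exponents)
    also have "\<dots> \<le> 2 * (\<Prod>j<2 * c. real (m + 1))"
    proof (intro mult_left_mono prod_mono conjI)
      \<comment> \<open>Each affine form has 1-norm at most
        \<open>2 * k + 2 * c \<le> 4 * k \<le> m + 1\<close>.\<close>
      fix j assume "j \<in> {..<2 * c}"
      then have r: "\<bar>r j\<bar> \<le> 2 * real c" by (auto simp: r_def)
      have "(\<Sum>i\<le>m. \<bar>a j i\<bar>) = (\<Sum>i<m. if i \<in> S then 1 else 0) + \<bar>r j\<bar>"
        using m by (auto simp: a_def simp flip: lessThan_Suc_atMost intro!: sum.cong)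
      also have "(\<Sum>i<m. if i \<in> S then 1 else 0 :: real) = 2 * real k"
        using S card by (simp add: sum.If_cases Int_absorb1)
      finally show "(\<Sum>i\<le>m. \<bar>a j i\<bar>) \<le> real (m + 1)"
        using r \<open>c \<le> k\<close> \<open>4 * k \<le> m + 1\<close> by linarith
    qed (auto intro: sum_nonneg)
    finally show "(\<Sum>f\<in>exponents m (2 * c). \<bar>w f\<bar>) \<le> 2 * real ((m + 1) ^ (2 * c))" by simp
  next
    fix x assume x: "x \<in> cube m" and small: "\<bar>\<Sum>i\<in>S. x i\<bar> \<le> 2 * int c"
    have xs: "x i \<in> {-1, 1}" if "i \<in> S" for i using that S cube_sign[OF x] by blast
    have affine: "(\<Sum>i<m. a j i * x i) + a j m = real_of_int ((\<Sum>i\<in>S. x i) - (2 * int j + 1 - 2 * int c))" for j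
    proof -
      have "(\<Sum>i<m. a j i * x i) = (\<Sum>i<m. if i \<in> S then real_of_int (x i) else 0)"
        by (intro sum.cong refl) (auto simp: a_def)
      also have "\<dots> = (\<Sum>i\<in>S. real_of_int (x i))"
        using S by (simp add: sum.If_cases Int_absorb1)
      finally show ?thesis using m by (simp add: a_def r_def)
    qed
    have "(\<Sum>f\<in>exponents m (2 * c). w f * monomial m (2 * c) x f) * parity S x
        = 2 * real_of_int ((\<Prod>i\<in>S. x i) * ((-1) ^ (k + c) *
            (\<Prod>j<2 * c. (\<Sum>i\<in>S. x i) - (2 * int j + 1 - 2 * int c))))"
      using prod_affine_eq_monomials[where a=a and x=x and m=m and d="2*c"] unfolding affine
      by (simp add: w_def parity_def sum_distrib_left mult_ac)
    also have "\<dots> \<ge> 2"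
      using parity_sign_polynomial[OF fin xs card small] by linarith
    finally show "(\<Sum>f\<in>exponents m (2 * c). w f * monomial m (2 * c) x f) * parity S x \<ge> 2" .
  qed
qed

section \<open>Vectors of monomials as examples, in an arbitrary fixed enumeration\<close>

definition monomial_vector :: "nat \<Rightarrow> nat \<Rightarrow> (nat \<Rightarrow> int) \<Rightarrow> int list" where
  "monomial_vector m d x =
     map (\<lambda>i. monomial m d x (from_nat_into (exponents m d) i)) [0..<(m + 1) ^ d]"

lemma sum_exponents_enum:
  "(\<Sum>i<(m + 1) ^ d. g (from_nat_into (exponents m d) i)) = (\<Sum>f\<in>exponents m d. g f)"
  using sum.reindex_bij_betw[OF bij_betw_from_nat_into_finite[OF finite_exponents], of g m d]
  by (simp add: card_exponents)

lemma monomial_vector_sign_vectors: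
  "x \<in> cube m \<Longrightarrow> monomial_vector m d x \<in> sign_vectors ((m + 1) ^ d)"
  using monomial_sign by (auto simp: monomial_vector_def sign_vectors_def)

text \<open>The weights of \<open>parity_threshold\<close> can miss the margin only where the sum
  exceeds \<open>2 * c\<close> in absolute value; the tail bound with \<open>d = 2 * c\<close> and
  \<open>card S = 2 * k\<close> gives the exponent.\<close>

lemma parity_almost_realizable:
  assumes S: "S \<subseteq> {..<m}" and card: "card S = 2 * k" and "c \<le> k" "4 * k \<le> m + 1"
    and \<eta>: "2 * exp (- (real c)\<^sup>2 / (2 * real k)) \<le> \<eta>"
  shows "almost_realizable_with_margin ((m + 1) ^ (2 * c)) (2 * real ((m + 1) ^ (2 * c))) \<eta>
    (labelled_pmf (cube m) (monomial_vector m (2 * c)) (parity S))"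
proof -
  let ?E = "exponents m (2 * c)" and ?n = "(m + 1) ^ (2 * c)"
  obtain w where w: "(\<Sum>f\<in>?E. \<bar>w f\<bar>) \<le> 2 * real ?n"
    "\<And>x. x \<in> cube m \<Longrightarrow> \<bar>\<Sum>i\<in>S. x i\<bar> \<le> 2 * int c \<Longrightarrow>
       (\<Sum>f\<in>?E. w f * monomial m (2 * c) x f) * parity S x \<ge> (2::real)"
    using parity_threshold[OF assms(1-4)] by blast
  define v where "v i = w (from_nat_into ?E i)" for i
  have inner: "(\<Sum>i<?n. v i * real_of_int (monomial_vector m (2 * c) x ! i))
      = (\<Sum>f\<in>?E. w f * monomial m (2 * c) x f)" for x
    by (subst sum_exponents_enum[symmetric]) (simp add: v_def monomial_vector_def)
  let ?bad = "{(x, y). real_of_int y * (\<Sum>i<?n. v i * real_of_int (x ! i)) \<le> 1}"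
  have ne: "cube m \<noteq> {}" using card_cube[of m] by (metis card.empty power_not_zero zero_neq_numeral)
  have "measure_pmf.prob (labelled_pmf (cube m) (monomial_vector m (2 * c)) (parity S)) ?bad
      = real (card (cube m \<inter> (\<lambda>x. (monomial_vector m (2 * c) x, parity S x)) -` ?bad)) / 2 ^ m"
    unfolding labelled_pmf_def by (simp add: measure_pmf_of_set ne finite_cube card_cube)
  also have "\<dots> \<le> real (card {x \<in> cube m. \<bar>real_of_int (\<Sum>i\<in>S. x i)\<bar> > 2 * real c}) / 2 ^ m"
  proof (intro divide_right_mono of_nat_mono card_mono subsetI)
    fix x assume "x \<in> cube m \<inter> (\<lambda>x. (monomial_vector m (2 * c) x, parity S x)) -` ?bad"
    then have x: "x \<in> cube m"
      and "parity S x * (\<Sum>i<?n. v i * real_of_int (monomial_vector m (2 * c) x ! i)) \<le> 1"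
      by simp_all
    then have "\<not> (\<Sum>f\<in>?E. w f * monomial m (2 * c) x f) * parity S x \<ge> 2"
      unfolding inner mult.commute[of "real_of_int (parity S x)"] by linarith
    with w(2)[OF x] have "2 * int c < \<bar>\<Sum>i\<in>S. x i\<bar>" by linarith
    then have "real_of_int (2 * int c) < real_of_int \<bar>\<Sum>i\<in>S. x i\<bar>"
      by (simp only: of_int_less_iff)
    with x show "x \<in> {x \<in> cube m. \<bar>real_of_int (\<Sum>i\<in>S. x i)\<bar> > 2 * real c}"
      by (simp del: of_int_sum)
  qed (simp_all add: finite_cube)
  also have "\<dots> \<le> 2 * exp (- (2 * real c)\<^sup>2 / (4 * real (card S)))"
    using sparse_sum_tail[OF S, of "2 * real c"] card \<open>c \<le> k\<close> by (simp add: field_simps)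
  also have "\<dots> = 2 * exp (- (real c)\<^sup>2 / (2 * real k))"
    by (simp add: card power2_eq_square)
  finally have "measure_pmf.prob (labelled_pmf (cube m) (monomial_vector m (2 * c)) (parity S)) ?bad \<le> \<eta>"
    using \<eta> by linarith
  moreover have "(\<Sum>i<?n. \<bar>v i\<bar>) \<le> 2 * real ?n"
    using w(1) sum_exponents_enum[of "\<lambda>f. \<bar>w f\<bar>" m "2 * c"] by (simp add: v_def)
  ultimately show ?thesis
    unfolding almost_realizable_with_margin_def by blast
qed

lemma orthogonal_labels_parity:
  "orthogonal_labels ((m + 1) ^ d) (cube m) (monomial_vector m d) {S. S \<subseteq> {..<m} \<and> card S = K} parity"
proof
  show "cube m \<noteq> {}" using card_cube[of m] by (metis card.empty power_not_zero zero_neq_numeral)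
  show "finite {S. S \<subseteq> {..<m} \<and> card S = K}"
    by (rule finite_subset[of _ "Pow {..<m}"]) auto
  show "monomial_vector m d x \<in> sign_vectors ((m + 1) ^ d)" if "x \<in> cube m" for x
    using that by (rule monomial_vector_sign_vectors)
qed (auto simp: finite_cube parity_orthogonal dest: parity_sign)

section \<open>Choice of parameters\<close>

text \<open>One additional factor \<open>n\<close> absorbs the constant hidden in the asymptotic
  bound.\<close>

lemma poly_bounded_eventually_le_power:
  assumes "poly_bounded q"
  shows "\<exists>p. \<forall>\<^sub>F n in sequentially. q n \<le> real n ^ p"
proof -
  obtain k where "q \<in> O(\<lambda>n. real n ^ k)" using assms by (auto simp: poly_bounded_def)
  then obtain C where C: "\<forall>\<^sub>F n in sequentially. norm (q n) \<le> C * norm (real n ^ k)"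
    by (elim landau_o.bigE)
  have "\<forall>\<^sub>F n in sequentially. C \<le> real n" by real_asymp
  with C have "\<forall>\<^sub>F n in sequentially. q n \<le> real n ^ Suc k"
  proof eventually_elim
    case (elim n)
    have "q n \<le> C * real n ^ k" using elim(1) by simp
    also have "\<dots> \<le> real n * real n ^ k" using elim(2) by (intro mult_right_mono) auto
    finally show ?case by simp
  qed
  then show ?thesis by blast
qed

text \<open>The dimension \<open>(m + 1) ^ d\<close> for \<open>K = 2 * u ^ (a + 1)\<close>,
  \<open>m = K^2\<close> and \<open>d = 2 * u ^ a\<close>.\<close>

definition encoding_length :: "nat \<Rightarrow> nat \<Rightarrow> nat" where
  "encoding_length a u = ((2 * u ^ (a + 1))\<^sup>2 + 1) ^ (2 * u ^ a)"

text \<open>From \<open>K^2 + 1 \<le> K^3\<close>. As a power of \<open>K\<close> the dimension is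
  easily compared with \<open>K ^ K\<close>.\<close>

lemma encoding_length_le:
  assumes "u \<ge> 1"
  shows "encoding_length a u \<le> (2 * u ^ (a + 1)) ^ (6 * u ^ a)"
proof -
  define K where "K = 2 * u ^ (a + 1)"
  have K: "K \<ge> 2" using assms by (simp add: K_def)
  have "K\<^sup>2 + 1 \<le> K\<^sup>2 + K\<^sup>2" using K by (simp add: power2_eq_square)
  also have "\<dots> \<le> K * K\<^sup>2" using mult_le_mono1[OF K, of "K\<^sup>2"] by (simp only: mult_2)
  finally have "K\<^sup>2 + 1 \<le> K ^ 3" by (simp add: power3_eq_cube power2_eq_square)
  then have "(K\<^sup>2 + 1) ^ (2 * u ^ a) \<le> (K ^ 3) ^ (2 * u ^ a)" by (rule power_mono) simp
  also have "\<dots> = K ^ (6 * u ^ a)" by (simp flip: power_mult)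
  finally show ?thesis by (simp only: encoding_length_def K_def)
qed

text \<open>Carries statements about all large \<open>n\<close> over to the dimensions given by
  large \<open>u\<close>.\<close>

lemma encoding_length_at_top: "filterlim (encoding_length a) at_top sequentially"
proof (rule filterlim_at_top_mono[OF filterlim_ident])
  have "u \<le> encoding_length a u" if "u \<ge> 1" for u
  proof -
    have "u \<le> u ^ (a + 1)" using that self_le_power[of u "a + 1"] by simp
    also have "\<dots> \<le> (u ^ (a + 1))\<^sup>2" by (rule self_le_power) (use that in auto)
    also have "\<dots> \<le> (2 * u ^ (a + 1))\<^sup>2 + 1" by (simp add: power_mult_distrib)
    also have "\<dots> \<le> encoding_length a u"
      unfolding encoding_length_def using that by (intro self_le_power) auto
    finally show ?thesis .
  qed
  then show "\<forall>\<^sub>F u in sequentially. u \<le> encoding_length a u"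
    by (rule eventually_mono[OF eventually_ge_at_top[of 1]])
qed

text \<open>For \<open>u > 3 * p\<close> the exponent \<open>6 * u ^ a * p\<close> is below
  \<open>K\<close>, and \<open>K ^ K = (K^2 / K) ^ K\<close> bounds the binomial coefficient from
  below.\<close>

lemma encoding_length_power_less_binomial:
  assumes "u > 3 * p"
  shows "real (encoding_length a u) ^ p < real ((2 * u ^ (a + 1))\<^sup>2 choose (2 * u ^ (a + 1)))"
proof -
  define K where "K = 2 * u ^ (a + 1)"
  have K: "K \<ge> 2" using assms by (simp add: K_def)
  have "encoding_length a u ^ p \<le> (K ^ (6 * u ^ a)) ^ p"
    using encoding_length_le[of u a] assms by (intro power_mono) (auto simp: K_def)
  also have "\<dots> = K ^ (6 * u ^ a * p)" by (simp add: power_mult)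
  also have "\<dots> < K ^ K"
  proof (rule power_strict_increasing)
    have "2 * u ^ a * (3 * p) < 2 * u ^ a * u" using assms by simp
    then show "6 * u ^ a * p < K" by (simp add: K_def mult_ac)
  qed (use K in simp)
  finally have "real (encoding_length a u) ^ p < real K ^ K" by (simp flip: of_nat_power)
  also have "\<dots> = (real (K\<^sup>2) / real K) ^ K" using K by (simp add: power2_eq_square)
  also have "\<dots> \<le> real (K\<^sup>2 choose K)"
    using K by (intro binomial_ge_n_over_k_pow_k) (simp add: power2_eq_square)
  finally show ?thesis by (simp add: K_def)
qed

lemma log_encoding_length_le:
  "\<forall>\<^sub>F u in sequentially. log 2 (real (encoding_length a u)) \<le> real u ^ (a + 1)"
proof -
  have "\<forall>\<^sub>F u in sequentially. 6 * (real a + 2) * log 2 (real u) \<le> real u"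
    by real_asymp
  then show ?thesis
    using eventually_ge_at_top[of 2]
  proof eventually_elim
    case (elim u)
    have "encoding_length a u \<le> (2 * u ^ (a + 1)) ^ (6 * u ^ a)"
      using elim by (intro encoding_length_le) simp
    also have "\<dots> \<le> (u ^ (a + 2)) ^ (6 * u ^ a)"
      using elim by (intro power_mono) auto
    finally have "real (encoding_length a u) \<le> real ((u ^ (a + 2)) ^ (6 * u ^ a))"
      by (simp only: of_nat_le_iff)
    then have "real (encoding_length a u) \<le> (real u ^ (a + 2)) ^ (6 * u ^ a)"
      by (simp only: of_nat_power)
    moreover have "encoding_length a u > 0" by (simp add: encoding_length_def)
    ultimately have "log 2 (real (encoding_length a u)) \<le> log 2 ((real u ^ (a + 2)) ^ (6 * u ^ a))"
      by simp
    also have "\<dots> = real u ^ a * (6 * (real a + 2) * log 2 (real u))"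
      using elim by (simp add: log_nat_power del: power_Suc add_2_eq_Suc')
    also have "\<dots> \<le> real u ^ a * real u" using elim by (intro mult_left_mono) auto
    finally show ?case by (simp add: mult.commute)
  qed
qed

text \<open>The tail exponent is \<open>u ^ (a - 1) / 2\<close>, whereas the noise exponent is of
  order at most \<open>u\<close> to the power \<open>(a + 1) * (1 - \<nu>)\<close> when \<nu> is at
  most 1; a large \<open>a\<close> makes the former dominate.\<close>

lemma tail_le_noise_rate:
  fixes \<nu> :: real
  assumes "\<nu> > 0"
  shows "\<exists>a. \<forall>\<^sub>F u in sequentially.
    2 * exp (- (real (u ^ a))\<^sup>2 / (2 * real (u ^ (a + 1))))
      \<le> 2 powr (- (log 2 (real (encoding_length a u)) powr (1 - \<nu>)))"
proof -
  \<comment> \<open>Capping at 1 keeps \<open>1 - \<mu>\<close> nonnegative, so that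
    \<open>powr (1 - \<mu>)\<close> is monotone in its base.\<close>
  define \<mu> where "\<mu> = min \<nu> 1"
  have \<mu>: "0 < \<mu>" "\<mu> \<le> 1" "\<mu> \<le> \<nu>" using assms by (auto simp: \<mu>_def)
  \<comment> \<open>Chosen so that \<open>(b + 3) * (1 - \<mu>) \<le> b\<close>. With
    \<open>a = b + 2\<close> the tail exponent is \<open>u ^ (b + 1) / 2\<close>, one factor
    \<open>u\<close> above the noise exponent.\<close>
  define b where "b = nat \<lceil>3 / \<mu>\<rceil>"
  define a where "a = b + 2"
  have "3 / \<mu> \<le> real b" by (simp add: b_def of_nat_ceiling)
  then have b: "3 \<le> real b * \<mu>" using \<mu> by (simp add: field_simps)
  have exponent: "(real a + 1) * (1 - \<mu>) \<le> real b"
  proof -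
    have "(real a + 1) * (1 - \<mu>) = real b + 3 - real b * \<mu> - 3 * \<mu>"
      by (simp add: a_def algebra_simps)
    then show ?thesis using b \<mu> by linarith
  qed
  have "\<forall>\<^sub>F u in sequentially.
    2 * exp (- (real (u ^ a))\<^sup>2 / (2 * real (u ^ (a + 1))))
      \<le> 2 powr (- (log 2 (real (encoding_length a u)) powr (1 - \<nu>)))"
    using log_encoding_length_le[of a] eventually_ge_at_top[of 4]
  proof eventually_elim
    case (elim u)
    define X where "X = log 2 (real (encoding_length a u)) powr (1 - \<nu>)"
    have "2 ^ 1 \<le> encoding_length a u"
    proof -
      have "2 ^ 1 \<le> (2 * u ^ (a + 1))\<^sup>2 + 1"
        using elim by (simp add: Suc_le_eq)
      also have "\<dots> \<le> encoding_length a u"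
        unfolding encoding_length_def using elim by (intro self_le_power) auto
      finally show ?thesis .
    qed
    then have log1: "1 \<le> log 2 (real (encoding_length a u))" by simp
    then have "X \<le> log 2 (real (encoding_length a u)) powr (1 - \<mu>)"
      using \<mu> by (simp add: X_def powr_mono)
    also have "\<dots> \<le> (real u ^ (a + 1)) powr (1 - \<mu>)"
      using log1 elim \<mu> by (intro powr_mono2) auto
    also have "\<dots> = real u powr ((real a + 1) * (1 - \<mu>))"
      using elim by (simp add: powr_powr add.commute flip: powr_realpow del: power_Suc)
    also have "\<dots> \<le> real u powr real b"
      using elim exponent by (intro powr_mono) auto
    also have "\<dots> = real u ^ b" using elim by (simp add: powr_realpow)
    finally have X: "X \<le> real u ^ b" .
    have ub: "1 \<le> real u ^ b" using elim by (intro one_le_power) simp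
    \<comment> \<open>The summand 1 accounts for the factor 2 in front of the exponential.\<close>
    have "ln 2 * (1 + X) \<le> 1 * (1 + X)"
      using ln_2_less_1 by (intro mult_right_mono) (auto simp: X_def)
    also have "\<dots> \<le> 2 * real u ^ b" using X ub by simp
    also have "\<dots> \<le> real u * real u ^ b / 2"
      using elim by simp
    also have "\<dots> = (real (u ^ a))\<^sup>2 / (2 * real (u ^ (a + 1)))"
      using elim by (simp add: a_def power2_eq_square)
    finally have "ln 2 + (- (real (u ^ a))\<^sup>2 / (2 * real (u ^ (a + 1)))) \<le> - X * ln 2"
      by (simp add: algebra_simps)
    then have "exp (ln 2 + (- (real (u ^ a))\<^sup>2 / (2 * real (u ^ (a + 1))))) \<le> exp (- X * ln 2)"
      by (simp only: exp_le_cancel_iff)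
    then show ?case by (simp only: exp_add powr_def X_def) simp
  qed
  then show ?thesis by blast
qed

theorem theorem3:
  fixes \<nu> :: real
  assumes "\<nu> > 0"
  shows "\<exists>B. poly_bounded B \<and>
    \<not> (\<exists>A. efficient_sq_algorithm A \<and>
          nontrivial_performance A
            (\<lambda>n. {D \<in> distributions n.
                   almost_realizable_with_margin n (B n)
                     (2 powr (- (log 2 (real n) powr (1 - \<nu>)))) D}))"
\<comment> \<open>Twice the dimension is the 1-norm bound supplied by
  \<open>parity_threshold\<close>.\<close>
proof (intro exI[of _ "\<lambda>n. 2 * real n"] conjI notI)
  have "(\<lambda>n. 2 * real n) \<in> O(\<lambda>n. real n ^ 1)" by simp
  then show "poly_bounded (\<lambda>n. 2 * real n)" unfolding poly_bounded_def by blast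
next
  define \<eta> where "\<eta> n = 2 powr (- (log 2 (real n) powr (1 - \<nu>)))" for n :: nat
  assume "\<exists>A. efficient_sq_algorithm A \<and>
          nontrivial_performance A
            (\<lambda>n. {D \<in> distributions n.
                   almost_realizable_with_margin n (2 * real n)
                     (2 powr (- (log 2 (real n) powr (1 - \<nu>)))) D})"
  then obtain A where eff: "efficient_sq_algorithm A"
    and nontriv: "nontrivial_performance A
      (\<lambda>n. {D \<in> distributions n. almost_realizable_with_margin n (2 * real n) (\<eta> n) D})"
    unfolding \<eta>_def by blast
  from nontriv obtain c where "c > 0" and c:
    "\<forall>\<^sub>F n in sequentially.
       \<forall>D \<in> {D \<in> distributions n. almost_realizable_with_margin n (2 * real n) (\<eta> n) D}.
       \<forall>as h. sq_run A n D as \<and> A n as = Output h \<longrightarrow> Err D h \<le> 1 / 2 - 1 / real n powr c"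
    unfolding nontrivial_performance_def by blast
  from c have perf: "\<forall>\<^sub>F n in sequentially. \<forall>D as h. D \<in> distributions n \<and>
       almost_realizable_with_margin n (2 * real n) (\<eta> n) D \<and>
       sq_run A n D as \<and> A n as = Output h \<longrightarrow> Err D h \<le> 1 / 2 - 1 / real n powr c"
    by eventually_elim blast
  have legal: "legal_sq_algorithm A" using eff by (simp add: efficient_sq_algorithm_def)
  from eff obtain q where "poly_bounded q" and queries:
    "\<And>n D as. D \<in> distributions n \<Longrightarrow> sq_run A n D as \<Longrightarrow> real (length as) \<le> q n"
    by (auto simp: efficient_sq_algorithm_def poly_many_queries_def)
  then obtain p1 where p1: "\<forall>\<^sub>F n in sequentially. q n \<le> real n ^ p1"
    using poly_bounded_eventually_le_power by blast
  from eff obtain t where "poly_bounded t" and tol: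
    "\<And>n D as Q \<tau>. D \<in> distributions n \<Longrightarrow> sq_run A n D as \<Longrightarrow> A n as = Query Q \<tau> \<Longrightarrow>
       1 / of_rat \<tau> \<le> t n"
    unfolding efficient_sq_algorithm_def poly_tolerance_def by blast
  then obtain p2 where p2: "\<forall>\<^sub>F n in sequentially. t n \<le> real n ^ p2"
    using poly_bounded_eventually_le_power by blast
  define p3 where "p3 = nat \<lceil>c\<rceil>"
  \<comment> \<open>The count required by \<open>fooled\<close> is at most
    \<open>2 * N ^ (p1 + 2 * p2 + 2 * p3)\<close>; the final \<open>+ 1\<close> absorbs the 2, as
    \<open>N \<ge> 2\<close>.\<close>
  define p where "p = p1 + 2 * p2 + 2 * p3 + 1"
  obtain a where tail: "\<forall>\<^sub>F u in sequentially.
    2 * exp (- (real (u ^ a))\<^sup>2 / (2 * real (u ^ (a + 1)))) \<le> \<eta> (encoding_length a u)"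
    using tail_le_noise_rate[OF assms] unfolding \<eta>_def by blast
  have "\<forall>\<^sub>F u in sequentially. False"
    using eventually_compose_filterlim[OF perf encoding_length_at_top[of a]]
      eventually_compose_filterlim[OF p1 encoding_length_at_top[of a]]
      eventually_compose_filterlim[OF p2 encoding_length_at_top[of a]]
      eventually_compose_filterlim[OF eventually_ge_at_top[of 2] encoding_length_at_top[of a]]
      tail eventually_gt_at_top[of "3 * p"]
  proof eventually_elim
    case (elim u)
    define n where "n = encoding_length a u"
    define k where "k = u ^ (a + 1)"
    define m where "m = (2 * k)\<^sup>2"
    define I where "I = {S. S \<subseteq> {..<m} \<and> card S = 2 * k}"
    define N where "N = real n"
    have N: "N \<ge> 2" using elim(4) by (simp add: N_def n_def)
    have n: "n = (m + 1) ^ (2 * u ^ a)" by (simp add: n_def encoding_length_def m_def k_def)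
    interpret orthogonal_labels n "cube m" "monomial_vector m (2 * u ^ a)" I parity
      unfolding n I_def by (rule orthogonal_labels_parity)
    have "\<exists>S\<in>I. \<exists>as h. sq_run A n (D S) as \<and> A n as = Output h \<and>
        Err (D S) h > 1 / 2 - 1 / N powr c"
    proof (rule fooled[of A "N ^ p1" "N ^ p2"])
      show "legal_sq_algorithm A" by (fact legal)
      show "real (length as) \<le> N ^ p1" if "sq_run A n D0 as" for as
        using queries[OF D0_distributions that] elim(2) unfolding N_def n_def by linarith
      show "1 / of_rat \<tau> \<le> N ^ p2" if "sq_run A n D0 as" "A n as = Query Q \<tau>" for as Q \<tau>
        using tol[OF D0_distributions that] elim(3) by (simp add: N_def n_def)
      show "N ^ p2 > 0" "1 / N powr c > 0" using N by auto
      have "N powr c \<le> N powr real p3"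
        using N by (intro powr_mono) (auto simp: p3_def of_nat_ceiling)
      also have "\<dots> = N ^ p3" using N by (simp add: powr_realpow)
      finally have "N powr c / 2 \<le> N ^ p3" using powr_ge_zero[of N c] by linarith
      then have "1 / (2 * (1 / N powr c)) \<le> N ^ p3" by simp
      then have "(1 / (2 * (1 / N powr c)))\<^sup>2 \<le> (N ^ p3)\<^sup>2"
        using N by (intro power_mono) auto
      also have "\<dots> \<le> N ^ (p1 + 2 * p2 + 2 * p3)"
        using N by (simp add: power_increasing flip: power_mult)
      finally have "N ^ p1 * (N ^ p2)\<^sup>2 + (1 / (2 * (1 / N powr c)))\<^sup>2
          \<le> N ^ (p1 + 2 * p2 + 2 * p3) + N ^ (p1 + 2 * p2 + 2 * p3)"
        using N power_increasing[of "p1 + 2 * p2" "p1 + 2 * p2 + 2 * p3" N]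
        by (intro add_mono) (simp_all add: power_add mult.commute flip: power_mult)
      also have "\<dots> = 2 * N ^ (p1 + 2 * p2 + 2 * p3)" by simp
      also have "\<dots> \<le> N ^ p" using N by (simp add: p_def)
      also have "\<dots> < real (card I)"
        using encoding_length_power_less_binomial[OF elim(6), of a]
        by (simp add: N_def n_def I_def n_subsets m_def k_def)
      finally show "real (card I) > N ^ p1 * (N ^ p2)\<^sup>2 + (1 / (2 * (1 / N powr c)))\<^sup>2" .
    qed
    then obtain S as h where S: "S \<in> I"
      and run: "sq_run A n (D S) as" "A n as = Output h" "Err (D S) h > 1 / 2 - 1 / N powr c"
      by blast
    \<comment> \<open>The fooling distribution belongs to the family, so the assumed performance
      contradicts its large error.\<close>
    have "almost_realizable_with_margin n (2 * real n) (\<eta> n) (D S)"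
      unfolding n
    proof (rule parity_almost_realizable)
      show "S \<subseteq> {..<m}" "card S = 2 * k" using S by (auto simp: I_def)
      show "u ^ a \<le> k" using elim(6) by (simp add: k_def)
      have "m = 4 * (k * k)" by (simp add: m_def power2_eq_square)
      then show "4 * k \<le> m + 1" using le_square[of k] by linarith
      show "2 * exp (- (real (u ^ a))\<^sup>2 / (2 * real k)) \<le> \<eta> ((m + 1) ^ (2 * u ^ a))"
        using elim(5) unfolding n[symmetric] n_def k_def .
    qed
    then have "Err (D S) h \<le> 1 / 2 - 1 / N powr c"
      using elim(1) D_distributions[OF S] run unfolding N_def n_def by blast
    with run show False by simp
  qed
  then show False by simp
qed

end
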